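(* Let $\phi$ be a flow on a (not necessarily compact) metric space $X$ which is geometrically separating and uniformly $C_0$. If $\phi$ is dynamically isolated at infinity, then $$\limsup_{T\to\infty}\frac1T\log\nu(T)\le e^{\mathrm{uc}}_{\mathrm{top}}(\phi),$$ where $\nu(T)$ is the number of distinct periodic orbits of $\phi$ with period in $[0,T]$.
   Context: A flow on a metric space $(X,d)$ is a family $\phi=(\phi_t)_{t\in\mathbb R}$ of maps $X\to X$ such that $(x,t)\mapsto\phi_t(x)$ is continuous, $\phi_0=\mathrm{id}_X$ and $\phi_{t+u}=\phi_t\circ\phi_u$ for all $t,u\in\mathbb R$. Put $\phi_{\mathbb R}(x)=\{\phi_t(x):t\in\mathbb R\}$ (the orbit of $x$). $\operatorname{Sing}(\phi)=\{x:\phi_t(x)=x\ \forall t\in\mathbb R\}$ and $X^*=X\setminus\operatorname{Sing}(\phi)$; a regular orbit is the orbit of a point of $X^*$. A point $x$ is periodic if there is a minimal number $\pi(x)>0$ (its period) with $\phi_{\pi(x)}(x)=x$; a periodic orbit is $\gamma=\phi_{\mathbb R}(x)$ with $x$ periodic, and its period is $\pi(\gamma)=\pi(x)$. Conventions: $\log 0=-\infty$, $\log\infty=\infty$. $\phi$ is geometrically separating if there is $\delta>0$ (a geometrically separating constant) such that whenever $x,y\in X$ and an increasing homeomorphism $s:\mathbb R\to\mathbb R$ with $s(0)=0$ satisfy $d(\phi_t(x),\phi_{s(t)}(y))<\delta$ for every $t\in\mathbb R$, then $y\in\phi_{\mathbb R}(x)$. $\phi$ is uniformly $C_0$ if $\lim_{t\to0}\sup_{x\in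 X}d(x,\phi_t(x))=0$. $\phi$ is dynamically isolated at infinity if there is a compact subset of $X$ meeting every regular orbit. For $T>0$ put $d_T^\phi(x,y)=\max_{0\le t\le T}d(\phi_t(x),\phi_t(y))$. For compact $K\subset X$ and $\varepsilon>0$, a set $E\subset K$ is $(T,\varepsilon)$-separated if $d_T^\phi(x,y)>\varepsilon$ for all distinct $x,y\in E$; $s_T^\phi(K,\varepsilon)$ is the maximal cardinality of such a set (finite). Set $$e^{\mathrm{uc}}_{\mathrm{top}}(\phi,K)=\lim_{\varepsilon\to0}\limsup_{T\to\infty}\frac1T\log s_T^\phi(K,\varepsilon),\qquad e^{\mathrm{uc}}_{\mathrm{top}}(\phi)=\sup_{K\subset X\ \mathrm{compact}}e^{\mathrm{uc}}_{\mathrm{top}}(\phi,K).$$ *)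

theory Defs
  imports "HOL-Analysis.Analysis"
begin

section \<open>Counting and logarithms with values in the extended reals\<close>

definition ecard :: "'a set \<Rightarrow> enat" where
  "ecard A = (if finite A then enat (card A) else \<infinity>)"

definition elog :: "enat \<Rightarrow> ereal" where
  "elog n = (case n of enat k \<Rightarrow> if k = 0 then -\<infinity> else ereal (ln (real k)) | \<infinity> \<Rightarrow> \<infinity>)"

lemma elog_mono: "m \<le> n \<Longrightarrow> elog m \<le> elog n"
  by (cases m; cases n) (auto simp: elog_def)

section \<open>Flows\<close>

definition flow :: "(real \<Rightarrow> 'a::metric_space \<Rightarrow> 'a) \<Rightarrow> bool" where
  "flow \<phi> \<longleftrightarrow> continuous_on UNIV (\<lambda>(x, t). \<phi> t x) \<and> \<phi> 0 = id \<and>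
     (\<forall>t u. \<phi> (t + u) = \<phi> t \<circ> \<phi> u)"

definition orbit :: "(real \<Rightarrow> 'a::metric_space \<Rightarrow> 'a) \<Rightarrow> 'a \<Rightarrow> 'a set" where
  "orbit \<phi> x = range (\<lambda>t. \<phi> t x)"

definition Sing :: "(real \<Rightarrow> 'a::metric_space \<Rightarrow> 'a) \<Rightarrow> 'a set" where
  "Sing \<phi> = {x. \<forall>t. \<phi> t x = x}"

definition geometrically_separating :: "(real \<Rightarrow> 'a::metric_space \<Rightarrow> 'a) \<Rightarrow> bool" where
  "geometrically_separating \<phi> \<longleftrightarrow>
     (\<exists>\<delta>>0. \<forall>x y s.
        (\<exists>s'. homeomorphism (UNIV::real set) (UNIV::real set) s s') \<and> strict_mono s \<and> s 0 = 0 \<and>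
        (\<forall>t. dist (\<phi> t x) (\<phi> (s t) y) < \<delta>) \<longrightarrow> y \<in> orbit \<phi> x)"

text \<open>The supremum is taken in the extended reals because it may be infinite when the space is
  unbounded.\<close>

definition uniformly_C0 :: "(real \<Rightarrow> 'a::metric_space \<Rightarrow> 'a) \<Rightarrow> bool" where
  "uniformly_C0 \<phi> \<longleftrightarrow> ((\<lambda>t. SUP x. ereal (dist x (\<phi> t x))) \<longlongrightarrow> 0) (at 0)"

definition dynamically_isolated_at_infinity :: "(real \<Rightarrow> 'a::metric_space \<Rightarrow> 'a) \<Rightarrow> bool" where
  "dynamically_isolated_at_infinity \<phi> \<longleftrightarrow>
     (\<exists>K. compact K \<and> (\<forall>x. x \<notin> Sing \<phi> \<longrightarrow> orbit \<phi> x \<inter> K \<noteq> {}))"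

section \<open>Periodic orbits\<close>

definition periodic_point :: "(real \<Rightarrow> 'a::metric_space \<Rightarrow> 'a) \<Rightarrow> 'a \<Rightarrow> bool" where
  "periodic_point \<phi> x \<longleftrightarrow>
     (\<exists>p>0. \<phi> p x = x \<and> (\<forall>q>0. \<phi> q x = x \<longrightarrow> p \<le> q))"

definition period :: "(real \<Rightarrow> 'a::metric_space \<Rightarrow> 'a) \<Rightarrow> 'a \<Rightarrow> real" where
  "period \<phi> x = (LEAST p. p > 0 \<and> \<phi> p x = x)"

definition num_periodic_orbits :: "(real \<Rightarrow> 'a::metric_space \<Rightarrow> 'a) \<Rightarrow> real \<Rightarrow> enat" where
  "num_periodic_orbits \<phi> T =
     ecard {orbit \<phi> x | x. periodic_point \<phi> x \<and> period \<phi> x \<in> {0..T}}"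

section \<open>Entropy on compact sets\<close>

text \<open>For a flow and \<open>T \<ge> 0\<close> the supremum is a maximum, see \<open>dyn_dist_attained\<close> below.\<close>

definition dyn_dist :: "(real \<Rightarrow> 'a::metric_space \<Rightarrow> 'a) \<Rightarrow> real \<Rightarrow> 'a \<Rightarrow> 'a \<Rightarrow> real" where
  "dyn_dist \<phi> T x y = (SUP t\<in>{0..T}. dist (\<phi> t x) (\<phi> t y))"

definition dyn_separated ::
    "(real \<Rightarrow> 'a::metric_space \<Rightarrow> 'a) \<Rightarrow> real \<Rightarrow> real \<Rightarrow> 'a set \<Rightarrow> bool" where
  "dyn_separated \<phi> T \<epsilon> E \<longleftrightarrow> (\<forall>x\<in>E. \<forall>y\<in>E. x \<noteq> y \<longrightarrow> dyn_dist \<phi> T x y > \<epsilon>)"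

definition sep_card ::
    "(real \<Rightarrow> 'a::metric_space \<Rightarrow> 'a) \<Rightarrow> real \<Rightarrow> 'a set \<Rightarrow> real \<Rightarrow> enat" where
  "sep_card \<phi> T K \<epsilon> = (SUP E\<in>{E. E \<subseteq> K \<and> dyn_separated \<phi> T \<epsilon> E}. ecard E)"

definition entropy_uc_on :: "(real \<Rightarrow> 'a::metric_space \<Rightarrow> 'a) \<Rightarrow> 'a set \<Rightarrow> ereal" where
  "entropy_uc_on \<phi> K =
     Lim (at_right 0) (\<lambda>\<epsilon>. Limsup at_top (\<lambda>T. ereal (1 / T) * elog (sep_card \<phi> T K \<epsilon>)))"

definition entropy_uc :: "(real \<Rightarrow> 'a::metric_space \<Rightarrow> 'a) \<Rightarrow> ereal" where
  "entropy_uc \<phi> = (SUP K\<in>{K. compact K}. entropy_uc_on \<phi> K)"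

section \<open>The maximum and the limit in these definitions exist\<close>

lemma dyn_dist_attained:
  assumes "flow \<phi>" "T \<ge> 0"
  shows "\<exists>t\<in>{0..T}. dyn_dist \<phi> T x y = dist (\<phi> t x) (\<phi> t y) \<and>
           (\<forall>u\<in>{0..T}. dist (\<phi> u x) (\<phi> u y) \<le> dist (\<phi> t x) (\<phi> t y))"
proof -
  have c: "continuous_on {0..T} (\<lambda>t. \<phi> t z)" for z
  proof -
    have "continuous_on {0..T} ((\<lambda>(x, t). \<phi> t x) \<circ> (\<lambda>t. (z, t)))"
      using assms(1) by (intro continuous_on_compose continuous_intros)
        (auto simp: flow_def intro: continuous_on_subset)
    then show ?thesis by (simp add: o_def)
  qed
  have "continuous_on {0..T} (\<lambda>t. dist (\<phi> t x) (\<phi> t y))"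
    by (intro continuous_intros c)
  then obtain t where t: "t \<in> {0..T}"
      "\<forall>u\<in>{0..T}. dist (\<phi> u x) (\<phi> u y) \<le> dist (\<phi> t x) (\<phi> t y)"
    using continuous_attains_sup[of "{0..T}"] assms(2) by force
  then have "dyn_dist \<phi> T x y = dist (\<phi> t x) (\<phi> t y)"
    unfolding dyn_dist_def by (intro cSup_eq_maximum) auto
  with t show ?thesis by blast
qed

lemma entropy_uc_on_tendsto:
  "((\<lambda>\<epsilon>. Limsup at_top (\<lambda>T. ereal (1 / T) * elog (sep_card \<phi> T K \<epsilon>)))
      \<longlongrightarrow> entropy_uc_on \<phi> K) (at_right 0)"
proof -
  let ?h = "\<lambda>\<epsilon>. Limsup at_top (\<lambda>T. ereal (1 / T) * elog (sep_card \<phi> T K \<epsilon>))"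
  have sep: "sep_card \<phi> T K b \<le> sep_card \<phi> T K a" if "a \<le> b" for a b T
    unfolding sep_card_def dyn_separated_def
    using that by (intro SUP_subset_mono) force+
  have anti: "?h b \<le> ?h a" if "a \<le> b" for a b
  proof (rule Limsup_mono)
    show "\<forall>\<^sub>F T in at_top. ereal (1 / T) * elog (sep_card \<phi> T K b)
            \<le> ereal (1 / T) * elog (sep_card \<phi> T K a)"
      using eventually_gt_at_top[of 0]
      by eventually_elim (intro ereal_mult_left_mono elog_mono sep that, simp)
  qed
  have "(?h \<longlongrightarrow> (SUP \<epsilon>\<in>{0<..}. ?h \<epsilon>)) (at_right 0)"
  proof (rule order_tendstoI)
    fix a assume "a < (SUP \<epsilon>\<in>{0<..}. ?h \<epsilon>)"
    then obtain e where e: "e > 0" "a < ?h e"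
      by (auto simp: less_SUP_iff)
    have "\<forall>\<^sub>F \<epsilon> in at_right (0::real). \<epsilon> < e"
      using e(1) eventually_at_right by blast
    then show "\<forall>\<^sub>F \<epsilon> in at_right 0. a < ?h \<epsilon>"
      by eventually_elim (use e(2) anti in \<open>meson less_imp_le less_le_trans\<close>)
  next
    fix a assume a: "(SUP \<epsilon>\<in>{0<..}. ?h \<epsilon>) < a"
    have "\<forall>\<^sub>F \<epsilon> in at_right (0::real). \<epsilon> > 0"
      by (simp add: eventually_at_right_less)
    then show "\<forall>\<^sub>F \<epsilon> in at_right 0. ?h \<epsilon> < a"
    proof eventually_elim
      case (elim \<epsilon>)
      then have "?h \<epsilon> \<le> (SUP \<epsilon>\<in>{0<..}. ?h \<epsilon>)"
        by (intro SUP_upper) simp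
      with a show ?case by (rule le_less_trans[rotated])
    qed
  qed
  moreover from this have "entropy_uc_on \<phi> K = (SUP \<epsilon>\<in>{0<..}. ?h \<epsilon>)"
    unfolding entropy_uc_on_def by (intro tendsto_Lim) simp_all
  ultimately show ?thesis by simp
qed

end

theory Submission
  imports Defs "HOL-Real_Asymp.Real_Asymp"
begin

text \<open>Choose a point of the compact set on every periodic orbit of period at most \<open>T\<close>. If two of these
  points have periods \<open>p\<close>, \<open>q\<close> with \<open>\<bar>p - q\<bar> < \<eta>\<close> and stay \<open>\<epsilon>\<close>-close up to time \<open>T\<close>, then the linear
  reparametrization \<open>t \<mapsto> (q / p) t\<close> keeps their whole orbits close: by periodicity only
  \<open>0 \<le> t < p\<close> matters, where it moves times by less than \<open>\<eta>\<close>, so that the uniform \<open>C\<^sub>0\<close> condition applies.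
  Geometric separation then makes the orbits equal. Hence the periodic orbits
  with periods in a given interval of length \<open>\<eta>\<close> yield a \<open>(T, \<epsilon>)\<close>-separated set, and
  \<open>\<nu>(T) \<le> (T / \<eta> + 1) s\<^sub>T(K, \<epsilon>)\<close>; the linear factor does not affect the exponential growth rate.\<close>

section \<open>Orbits and periods\<close>

lemma flow_0: "flow \<phi> \<Longrightarrow> \<phi> 0 x = x"
  by (simp add: flow_def)

lemma flow_add: "flow \<phi> \<Longrightarrow> \<phi> (t + u) x = \<phi> t (\<phi> u x)"
  by (simp add: flow_def)

lemma orbit_eq:
  assumes "flow \<phi>" "y \<in> orbit \<phi> x"
  shows "orbit \<phi> y = orbit \<phi> x"
proof -
  obtain u where u: "y = \<phi> u x"
    using assms(2) by (auto simp: orbit_def)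
  have "\<phi> t y = \<phi> (t + u) x" for t
    by (simp add: u flow_add[OF assms(1)])
  moreover have "\<phi> t x = \<phi> (t - u) y" for t
    using flow_add[OF assms(1), of "t - u" u x] by (simp add: u)
  ultimately show ?thesis
    unfolding orbit_def by (metis (no_types, lifting) image_cong image_subset_iff rangeI subset_antisym)
qed

lemma flow_int_multiple:
  assumes "flow \<phi>" "\<phi> p x = x"
  shows "\<phi> (of_int n * p) x = x"
proof -
  have nat: "\<phi> (real m * p) x = x" for m
    by (induction m)
      (simp_all add: flow_0[OF assms(1)] flow_add[OF assms(1)] assms(2) distrib_right)
  show ?thesis
  proof (cases n rule: int_cases2)
    case (nonneg m)
    then show ?thesis using nat[of m] by simp
  next
    case (nonpos m)
    have "\<phi> (- (real m * p)) (\<phi> (real m * p) x) = x"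
      using flow_add[OF assms(1), of "- (real m * p)" "real m * p" x] flow_0[OF assms(1)] by simp
    then show ?thesis using nat[of m] nonpos by simp
  qed
qed

text \<open>At a singular point every positive time is a return time, so none is minimal: half of
  \<open>p\<close> would already return. This makes every periodic orbit a regular one, hence one
  that meets the compact set.\<close>

lemma periodic_point_not_Sing:
  assumes "periodic_point \<phi> x"
  shows "x \<notin> Sing \<phi>"
proof
  assume "x \<in> Sing \<phi>"
  moreover obtain p where "p > 0" "\<forall>q>0. \<phi> q x = x \<longrightarrow> p \<le> q"
    using assms by (auto simp: periodic_point_def)
  ultimately have "p \<le> p / 2" "p > 0"
    by (simp_all only: Sing_def mem_Collect_eq half_gt_zero)
  then show False by simp
qed

text \<open>\<open>LEAST\<close> on the reals is informative only when a minimum exists; the witness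
  in \<open>periodic_point\<close> is that minimum.\<close>

lemma period_works:
  assumes "periodic_point \<phi> x"
  shows "period \<phi> x > 0" "\<phi> (period \<phi> x) x = x"
proof -
  obtain p where p: "p > 0" "\<phi> p x = x" "\<forall>q>0. \<phi> q x = x \<longrightarrow> p \<le> q"
    using assms by (auto simp: periodic_point_def)
  have "period \<phi> x = p"
    unfolding period_def by (rule Least_equality) (use p in auto)
  with p show "period \<phi> x > 0" "\<phi> (period \<phi> x) x = x" by auto
qed

section \<open>Comparing two periodic orbits by a linear change of time\<close>

lemma homeomorphism_scale:
  fixes c :: real
  assumes "c > 0"
  shows "homeomorphism UNIV UNIV (\<lambda>t. c * t) (\<lambda>t. t / c)"
  using assms by (intro homeomorphismI continuous_intros) auto

lemma uniformly_C0_bound: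
  assumes "flow \<phi>" "uniformly_C0 \<phi>" "e > 0"
  obtains \<eta> where "\<eta> > 0" "\<And>x t. \<bar>t\<bar> < \<eta> \<Longrightarrow> dist x (\<phi> t x) < e"
proof -
  have "\<forall>\<^sub>F t in at 0. (SUP x. ereal (dist x (\<phi> t x))) < ereal e"
    using assms(2,3) unfolding uniformly_C0_def by (intro order_tendstoD) auto
  then obtain \<eta> where \<eta>: "\<eta> > 0"
      "\<And>t. t \<noteq> 0 \<Longrightarrow> \<bar>t\<bar> < \<eta> \<Longrightarrow> (SUP x. ereal (dist x (\<phi> t x))) < ereal e"
    by (auto simp: eventually_at)
  \<comment> \<open>The filter \<open>at 0\<close> leaves out \<open>t = 0\<close>, where the
    distance vanishes because \<open>\<phi> 0\<close> is the identity.\<close>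
  have "dist x (\<phi> t x) < e" if "\<bar>t\<bar> < \<eta>" for x t
  proof (cases "t = 0")
    case True
    then show ?thesis using assms by (simp add: flow_0)
  next
    case False
    have "ereal (dist x (\<phi> t x)) \<le> (SUP x. ereal (dist x (\<phi> t x)))"
      by (rule SUP_upper) simp
    also have "\<dots> < ereal e"
      using \<eta>(2)[OF False that] .
    finally show ?thesis by simp
  qed
  with \<eta>(1) that show thesis by blast
qed

text \<open>Multiplication by \<open>q / p\<close> turns \<open>n\<close> turns of length
  \<open>p\<close> into \<open>n\<close> turns of length \<open>q\<close>, so whole turns drop out
  on both sides at once and only the remainder \<open>r\<close> in \<open>[0, p)\<close> is
  left.\<close>

lemma periodic_scaled_dist:
  fixes \<phi> :: "real \<Rightarrow> 'a::metric_space \<Rightarrow> 'a"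
  assumes flow: "flow \<phi>"
    and p: "p > 0" "\<phi> p x = x" and q: "q > 0" "\<phi> q y = y"
    and T: "p \<le> T" and close: "dyn_dist \<phi> T x y \<le> \<epsilon>"
    and C0: "\<And>z t. \<bar>t\<bar> < \<eta> \<Longrightarrow> dist z (\<phi> t z) < e" and pq: "\<bar>p - q\<bar> < \<eta>"
  shows "dist (\<phi> t x) (\<phi> (q / p * t) y) < \<epsilon> + e"
proof -
  define n where "n = \<lfloor>t / p\<rfloor>"
  define r where "r = t - of_int n * p"
  have "of_int n \<le> t / p" "t / p < of_int n + 1"
    unfolding n_def by linarith+
  then have r: "0 \<le> r" "r < p"
    using p(1) by (auto simp: r_def field_simps)
  have t: "t = r + of_int n * p"
    by (simp add: r_def)
  have st: "q / p * t = q / p * r + of_int n * q"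
    using p(1) by (simp add: t field_simps)
  have 1: "\<phi> t x = \<phi> r x"
    unfolding t flow_add[OF flow] flow_int_multiple[OF flow p(2)] ..
  have 2: "\<phi> (q / p * t) y = \<phi> (q / p * r) y"
    unfolding st flow_add[OF flow] flow_int_multiple[OF flow q(2)] ..
  \<comment> \<open>The rescaled point is reached from \<open>\<phi> r y\<close> by a short flow
    time, so \<open>C0\<close> applies at \<open>\<phi> r y\<close>, which is compared with
    \<open>\<phi> r x\<close> below.\<close>
  have 3: "\<phi> (q / p * r) y = \<phi> (q / p * r - r) (\<phi> r y)"
    using flow_add[OF flow, of "q / p * r - r" r y] by simp
  have "\<bar>q / p * r - r\<bar> = \<bar>r / p * (q - p)\<bar>"
    using p(1) by (simp add: field_simps)
  also have "\<dots> = r / p * \<bar>p - q\<bar>"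
    using r(1) p(1) by (simp add: abs_mult abs_minus_commute)
  also have "\<dots> \<le> 1 * \<bar>p - q\<bar>"
    by (rule mult_right_mono) (use r p(1) in auto)
  finally have "\<bar>q / p * r - r\<bar> < \<eta>"
    using pq by simp
  then have 4: "dist (\<phi> r y) (\<phi> (q / p * r) y) < e"
    using C0 3 by metis
  have "dist (\<phi> r x) (\<phi> r y) \<le> dyn_dist \<phi> T x y"
    using dyn_dist_attained[OF flow, of T x y] r T by force
  with close 4 dist_triangle[of "\<phi> r x" "\<phi> (q / p * r) y" "\<phi> r y"]
  show ?thesis unfolding 1 2 by linarith
qed

section \<open>Counting periodic orbits by separated sets\<close>

lemma ecard_le_sep_card:
  "E \<subseteq> K \<Longrightarrow> dyn_separated \<phi> T \<epsilon> E \<Longrightarrow> ecard E \<le> sep_card \<phi> T K \<epsilon>"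
  unfolding sep_card_def by (rule SUP_upper) simp

lemma ecard_le_fibres:
  assumes "finite I" "f ` A \<subseteq> I" "\<And>i. i \<in> I \<Longrightarrow> ecard {a \<in> A. f a = i} \<le> enat m"
  shows "ecard A \<le> enat (card I * m)"
proof -
  have fib: "finite {a \<in> A. f a = i}" "card {a \<in> A. f a = i} \<le> m" if "i \<in> I" for i
    using assms(3)[OF that] by (auto simp: ecard_def split: if_splits)
  have A: "A = (\<Union>i\<in>I. {a \<in> A. f a = i})"
    using assms(2) by auto
  have "finite A"
    using fib(1) assms(1) by (subst A) blast
  have "card A \<le> (\<Sum>i\<in>I. card {a \<in> A. f a = i})"
    using card_UN_le[OF assms(1), of "\<lambda>i. {a \<in> A. f a = i}"] A by simp
  also have "\<dots> \<le> card I * m"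
    using sum_bounded_above[of I "\<lambda>i. card {a \<in> A. f a = i}" m] fib(2) by simp
  finally show ?thesis
    using \<open>finite A\<close> by (simp add: ecard_def)
qed

lemma num_periodic_orbits_le:
  fixes \<phi> :: "real \<Rightarrow> 'a::metric_space \<Rightarrow> 'a"
  assumes flow: "flow \<phi>"
    and sep: "\<And>x y s s'. homeomorphism (UNIV::real set) (UNIV::real set) s s' \<Longrightarrow> strict_mono s \<Longrightarrow>
        s 0 = 0 \<Longrightarrow> (\<And>t. dist (\<phi> t x) (\<phi> (s t) y) < \<delta>) \<Longrightarrow> y \<in> orbit \<phi> x"
    and K: "\<And>x. x \<notin> Sing \<phi> \<Longrightarrow> orbit \<phi> x \<inter> K \<noteq> {}"
    and C0: "\<And>z t. \<bar>t\<bar> < \<eta> \<Longrightarrow> dist z (\<phi> t z) < e"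
    and \<eta>: "\<eta> > 0" and \<epsilon>: "\<epsilon> + e \<le> \<delta>" and fin: "sep_card \<phi> T K \<epsilon> = enat m"
  shows "num_periodic_orbits \<phi> T \<le> enat (Suc (nat \<lfloor>T / \<eta>\<rfloor>) * m)"
proof -
  define P where "P = {orbit \<phi> x | x. periodic_point \<phi> x \<and> period \<phi> x \<in> {0..T}}"
  have "\<exists>z p. z \<in> K \<and> orbit \<phi> z = \<gamma> \<and> 0 < p \<and> p \<le> T \<and> \<phi> p z = z" if "\<gamma> \<in> P" for \<gamma>
  proof -
    obtain x where x: "\<gamma> = orbit \<phi> x" "periodic_point \<phi> x" "period \<phi> x \<le> T"
      using \<open>\<gamma> \<in> P\<close> by (auto simp: P_def)
    obtain z where z: "z \<in> orbit \<phi> x" "z \<in> K"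
      using K[OF periodic_point_not_Sing[OF x(2)]] by blast
    then obtain u where u: "z = \<phi> u x"
      by (auto simp: orbit_def)
    \<comment> \<open>Flow maps commute, so the period of \<open>x\<close> is a return time of every
      point of its orbit. Only this is recorded for \<open>z\<close>; minimality is not
      transported.\<close>
    have "\<phi> (period \<phi> x) z = \<phi> u (\<phi> (period \<phi> x) x)"
      unfolding u flow_add[OF flow, symmetric] by (simp add: add.commute)
    then have "\<phi> (period \<phi> x) z = z"
      by (simp add: period_works(2)[OF x(2)] u)
    then show ?thesis
      using z orbit_eq[OF flow z(1)] period_works(1)[OF x(2)] x by blast
  qed
  then obtain z p where zp: "\<And>\<gamma>. \<gamma> \<in> P \<Longrightarrow>
      z \<gamma> \<in> K \<and> orbit \<phi> (z \<gamma>) = \<gamma> \<and> 0 < p \<gamma> \<and> p \<gamma> \<le> T \<and> \<phi> (p \<gamma>) (z \<gamma>) = z \<gamma>"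
    by metis
  \<comment> \<open>Return times are sorted into windows of length \<open>\<eta>\<close>; two in the
    same window differ by less than \<open>\<eta>\<close>.\<close>
  define k where "k \<gamma> = nat \<lfloor>p \<gamma> / \<eta>\<rfloor>" for \<gamma>
  have "ecard {\<gamma> \<in> P. k \<gamma> = i} \<le> enat m" for i
  proof -
    let ?A = "{\<gamma> \<in> P. k \<gamma> = i}"
    have "dyn_separated \<phi> T \<epsilon> (z ` ?A)"
      unfolding dyn_separated_def
    proof (intro ballI impI, elim imageE)
      fix x y \<gamma> \<beta>
      assume ne: "x \<noteq> y" and x: "x = z \<gamma>" "\<gamma> \<in> ?A" and y: "y = z \<beta>" "\<beta> \<in> ?A"
      show "\<epsilon> < dyn_dist \<phi> T x y"
      proof (rule ccontr)
        assume "\<not> \<epsilon> < dyn_dist \<phi> T x y"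
        then have close: "dyn_dist \<phi> T x y \<le> \<epsilon>" by simp
        have *: "p \<gamma> > 0" "\<phi> (p \<gamma>) x = x" "p \<beta> > 0" "\<phi> (p \<beta>) y = y" "p \<gamma> \<le> T"
          using zp x y by auto
        have "\<lfloor>p \<gamma> / \<eta>\<rfloor> = \<lfloor>p \<beta> / \<eta>\<rfloor>"
          using x(2) y(2) *(1,3) \<eta> by (auto simp: k_def eq_nat_nat_iff)
        then have "\<bar>p \<gamma> / \<eta> - p \<beta> / \<eta>\<bar> < 1"
          by linarith
        then have "\<bar>(p \<gamma> - p \<beta>) / \<eta>\<bar> < 1"
          by (simp add: diff_divide_distrib)
        then have pq: "\<bar>p \<gamma> - p \<beta>\<bar> < \<eta>"
          using \<eta> by simp
        have "y \<in> orbit \<phi> x"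
        proof (rule sep[OF homeomorphism_scale[of "p \<beta> / p \<gamma>"]])
          show "strict_mono ((*) (p \<beta> / p \<gamma>))"
            using * by (intro strict_monoI mult_strict_left_mono) auto
          show "dist (\<phi> t x) (\<phi> (p \<beta> / p \<gamma> * t) y) < \<delta>" for t
            using periodic_scaled_dist[OF flow * close C0 pq, of t] \<epsilon> by simp
        qed (use * in auto)
        then have "orbit \<phi> y = orbit \<phi> x"
          by (rule orbit_eq[OF flow])
        \<comment> \<open>An orbit determines its chosen point, so equal orbits would force
          \<open>x = y\<close>.\<close>
        then show False
          using zp x y ne by auto
      qed
    qed
    moreover have "z ` ?A \<subseteq> K"
      using zp by auto
    ultimately have "ecard (z ` ?A) \<le> enat m"
      using ecard_le_sep_card fin by metis
    \<comment> \<open>The orbit of \<open>z \<gamma>\<close> is \<open>\<gamma>\<close> again, so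
      passing to chosen points loses no orbit, and the bound on the image also shows that the fibre
      is finite.\<close>
    moreover have "inj_on z ?A"
      by (rule inj_onI) (use zp in \<open>metis (mono_tags, lifting) mem_Collect_eq\<close>)
    ultimately show ?thesis
      by (simp add: ecard_def card_image finite_image_iff split: if_splits)
  qed
  moreover have "k ` P \<subseteq> {..nat \<lfloor>T / \<eta>\<rfloor>}"
    using zp \<eta> by (auto simp: k_def intro!: nat_mono floor_mono divide_right_mono)
  ultimately have "ecard P \<le> enat (card {..nat \<lfloor>T / \<eta>\<rfloor>} * m)"
    by (intro ecard_le_fibres) auto
  then show ?thesis
    by (simp add: num_periodic_orbits_def P_def)
qed

section \<open>Exponential growth rates\<close>

lemma elog_le_of_le_mult:
  assumes "\<nu> \<le> enat (c * m)" "c > 0"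
  shows "elog \<nu> \<le> elog (enat m) + ereal (ln (real c))"
proof -
  have "elog \<nu> \<le> elog (enat (c * m))"
    by (rule elog_mono[OF assms(1)])
  \<comment> \<open>This covers \<open>m = 0\<close> too: both sides are then minus infinity, since
    the logarithm of \<open>c\<close> is finite.\<close>
  also have "\<dots> = elog (enat m) + ereal (ln (real c))"
    using assms(2) by (simp add: elog_def ln_mult)
  finally show ?thesis .
qed

lemma tendsto_ln_linear_over:
  fixes a :: real
  assumes "a > 0"
  shows "((\<lambda>T. ln (a * T + 1) / T) \<longlongrightarrow> 0) at_top"
  using assms by real_asymp

theorem theorem1p2:
  fixes \<phi> :: "real \<Rightarrow> 'a::metric_space \<Rightarrow> 'a"
  assumes "flow \<phi>"
    and "geometrically_separating \<phi>"
    and "uniformly_C0 \<phi>"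
    and "dynamically_isolated_at_infinity \<phi>"
  shows "Limsup at_top (\<lambda>T. ereal (1 / T) * elog (num_periodic_orbits \<phi> T)) \<le> entropy_uc \<phi>"
proof -
  let ?\<nu> = "\<lambda>T. ereal (1 / T) * elog (num_periodic_orbits \<phi> T)"
  obtain \<delta> where \<delta>: "\<delta> > 0" and sep: "\<And>x y s s'. homeomorphism (UNIV::real set) (UNIV::real set) s s' \<Longrightarrow>
      strict_mono s \<Longrightarrow> s 0 = 0 \<Longrightarrow> (\<And>t. dist (\<phi> t x) (\<phi> (s t) y) < \<delta>) \<Longrightarrow> y \<in> orbit \<phi> x"
    using assms(2) unfolding geometrically_separating_def by blast
  obtain K where K: "compact K" "\<And>x. x \<notin> Sing \<phi> \<Longrightarrow> orbit \<phi> x \<inter> K \<noteq> {}"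
    using assms(4) unfolding dynamically_isolated_at_infinity_def by blast
  \<comment> \<open>The separating constant is shared equally: half for the change of time, half for
    \<open>\<epsilon>\<close>.\<close>
  obtain \<eta> where \<eta>: "\<eta> > 0" "\<And>x t. \<bar>t\<bar> < \<eta> \<Longrightarrow> dist x (\<phi> t x) < \<delta> / 2"
    using uniformly_C0_bound[OF assms(1,3), of "\<delta> / 2"] \<delta> by auto
  let ?s = "\<lambda>\<epsilon> T. ereal (1 / T) * elog (sep_card \<phi> T K \<epsilon>)"
  have main: "?\<nu> T \<le> ?s \<epsilon> T + ereal (ln (1 / \<eta> * T + 1) / T)" if "T > 0" "\<epsilon> \<le> \<delta> / 2" for T \<epsilon>
  proof (cases "sep_card \<phi> T K \<epsilon>")
    case (enat m)
    define c where "c = Suc (nat \<lfloor>T / \<eta>\<rfloor>)"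
    have "c > 0"
      by (simp add: c_def)
    have "real c \<le> 1 / \<eta> * T + 1"
      using that(1) \<eta>(1) by (simp add: c_def)
    then have c: "ln (real c) \<le> ln (1 / \<eta> * T + 1)"
      using \<open>c > 0\<close> by (intro ln_mono) auto
    have "num_periodic_orbits \<phi> T \<le> enat (c * m)"
      unfolding c_def
    proof (rule num_periodic_orbits_le[OF assms(1) _ K(2) \<eta>(2) \<eta>(1) _ enat])
      show "\<epsilon> + \<delta> / 2 \<le> \<delta>"
        using \<open>\<epsilon> \<le> \<delta> / 2\<close> by simp
    qed (fact sep)
    then have "elog (num_periodic_orbits \<phi> T) \<le> elog (enat m) + ereal (ln (real c))"
      using \<open>c > 0\<close> by (rule elog_le_of_le_mult)
    also have "\<dots> \<le> elog (enat m) + ereal (ln (1 / \<eta> * T + 1))"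
      using c by (intro add_left_mono) simp
    finally have "?\<nu> T \<le> ereal (1 / T) * (elog (enat m) + ereal (ln (1 / \<eta> * T + 1)))"
      using that(1) by (intro ereal_mult_left_mono) auto
    also have "\<dots> = ?s \<epsilon> T + ereal (ln (1 / \<eta> * T + 1) / T)"
      using that(1) by (simp add: enat ereal_distrib_left elog_def field_simps)
    finally show ?thesis .
  next
    \<comment> \<open>The right-hand side is infinite here, so no finiteness of
      \<open>sep_card\<close> has to be established.\<close>
    case infinity
    then show ?thesis using that(1) by (simp add: elog_def)
  qed
  have bound: "Limsup at_top ?\<nu> \<le> Limsup at_top (?s \<epsilon>)" if "\<epsilon> \<le> \<delta> / 2" for \<epsilon>
  \<comment> \<open>The correction term is eventually below any \<open>e > 0\<close>; replacing it
    by the constant \<open>e\<close> lets it be pulled out of the \<open>Limsup\<close>.\<close>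
  proof (rule ereal_le_epsilon2)
    fix e :: real
    assume "e > 0"
    then have "\<forall>\<^sub>F T in at_top. ln (1 / \<eta> * T + 1) / T < e"
      using \<eta>(1) by (intro order_tendstoD(2)[OF tendsto_ln_linear_over]) auto
    then have "\<forall>\<^sub>F T in at_top. ?\<nu> T \<le> ?s \<epsilon> T + ereal e"
      using eventually_gt_at_top[of 0]
    proof eventually_elim
      case (elim T)
      then show ?case
        by (intro order_trans[OF main[OF elim(2) that]] add_left_mono) simp
    qed
    then have "Limsup at_top ?\<nu> \<le> Limsup at_top (\<lambda>T. ?s \<epsilon> T + ereal e)"
      by (rule Limsup_mono)
    also have "\<dots> = Limsup at_top (?s \<epsilon>) + ereal e"
      by (rule Limsup_add_ereal_right) auto
    finally show "Limsup at_top ?\<nu> \<le> Limsup at_top (?s \<epsilon>) + ereal e" .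
  qed
  have "\<forall>\<^sub>F \<epsilon> in at_right 0. \<epsilon> < \<delta> / 2"
    using \<delta> by (auto simp: eventually_at_right[of 0 1] intro: exI[of _ "\<delta> / 2"])
  then have "\<forall>\<^sub>F \<epsilon> in at_right 0. Limsup at_top ?\<nu> \<le> Limsup at_top (?s \<epsilon>)"
    by eventually_elim (rule bound, simp)
  \<comment> \<open>The left-hand side does not depend on \<open>\<epsilon>\<close>, so the bound
    survives the limit as \<open>\<epsilon>\<close> tends to 0 from the right.\<close>
  then have "Limsup at_top ?\<nu> \<le> entropy_uc_on \<phi> K"
    by (intro tendsto_lowerbound[OF entropy_uc_on_tendsto]) auto
  also have "\<dots> \<le> entropy_uc \<phi>"
    unfolding entropy_uc_def using K(1) by (intro SUP_upper) simp
  finally show ?thesis .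
qed

end
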